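(* Let $\tau=\frac{1+\sqrt5}{2}$. For $\kappa\in(0,\infty)$ let $\epsilon=\frac{\tau-\kappa}{\kappa+\tau-1}$, $A=\tau-\frac{\epsilon}{\tau}$, $B=1+\epsilon$ (so that $A/B=\kappa$ and $A,B>0$), and let $x_m^{(\kappa)}=\left\|\frac{m}{\tau}\right\|A+\left(m-\left\|\frac{m}{\tau}\right\|\right)B$, $m\in\mathbb{Z}$, be the corresponding modified Fibonacci chain. Put $a=\frac{\tau+2}{\tau+1}$, $k_0=\frac{2\pi}{a}$, $q_0=\frac{2\pi}{\tau a}$. Then for all integers $n_1,n_2$, the amplitude of the peak at $K=n_1k_0+n_2q_0$, $$F_\kappa(K)=\lim_{N\to\infty}\frac1N\sum_{m=1}^{N}\exp\left(iKx_m^{(\kappa)}\right),$$ is an infinitely differentiable (in particular continuous) function of $\kappa\in(0,\infty)$.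
   Context: $\|x\|$ denotes the nearest integer to the real number $x$, with half-integers rounded up: if $m\in\mathbb{Z}$ and $m\le x<m+1$, then $\|x\|=m$ for $x\in[m,m+\frac12)$ and $\|x\|=m+1$ for $x\in[m+\frac12,m+1)$. The positions $K=n_1k_0+n_2q_0$ of the peaks do not depend on $\kappa$. *)

theory Defs
  imports "HOL-Analysis.Analysis"
begin

definition tau :: real where
  "tau = (1 + sqrt 5) / 2"

definition fib_eps :: "real \<Rightarrow> real" where
  "fib_eps \<kappa> = (tau - \<kappa>) / (\<kappa> + tau - 1)"

definition fib_A :: "real \<Rightarrow> real" where
  "fib_A \<kappa> = tau - fib_eps \<kappa> / tau"

definition fib_B :: "real \<Rightarrow> real" where
  "fib_B \<kappa> = 1 + fib_eps \<kappa>"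

text \<open>The nearest integer is the library function \<^const>\<open>round\<close>, which rounds half-integers up.\<close>

lemma round_nearest_half_up:
  fixes x :: real and m :: int
  shows "\<lbrakk>of_int m \<le> x; x < of_int m + 1/2\<rbrakk> \<Longrightarrow> round x = m"
    and "\<lbrakk>of_int m + 1/2 \<le> x; x < of_int m + 1\<rbrakk> \<Longrightarrow> round x = m + 1"
  unfolding round_def by linarith+

definition fib_chain :: "real \<Rightarrow> int \<Rightarrow> real" where
  "fib_chain \<kappa> m =
     of_int (round (of_int m / tau)) * fib_A \<kappa> +
     of_int (m - round (of_int m / tau)) * fib_B \<kappa>"

definition fib_a :: real where
  "fib_a = (tau + 2) / (tau + 1)"

definition k0 :: real where
  "k0 = 2 * pi / fib_a"

definition q0 :: real where
  "q0 = 2 * pi / (tau * fib_a)"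

definition peak_pos :: "int \<Rightarrow> int \<Rightarrow> real" where
  "peak_pos n1 n2 = of_int n1 * k0 + of_int n2 * q0"

definition exp_mean :: "real \<Rightarrow> real \<Rightarrow> nat \<Rightarrow> complex" where
  "exp_mean \<kappa> K N =
     1 / of_nat N * (\<Sum>m=1..N. exp (\<i> * complex_of_real (K * fib_chain \<kappa> (int m))))"

text \<open>\<^const>\<open>lim\<close> is an arbitrary value if the sequence diverges, so
  convergence of \<^const>\<open>exp_mean\<close> has to be asserted separately.\<close>

definition peak_amplitude :: "real \<Rightarrow> real \<Rightarrow> complex" where
  "peak_amplitude \<kappa> K = lim (exp_mean \<kappa> K)"

text \<open>Meant for open \<open>S\<close>. The \<open>n\<close>-fold iterate below is the \<open>n\<close>-th derivative of \<open>f\<close>;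
  its values outside \<open>S\<close> do not influence the differentiability at points of \<open>S\<close>.\<close>

definition infinitely_differentiable_on ::
    "real set \<Rightarrow> (real \<Rightarrow> 'a::real_normed_vector) \<Rightarrow> bool" where
  "infinitely_differentiable_on S f \<longleftrightarrow>
     (\<forall>n. \<forall>x\<in>S. ((\<lambda>g y. vector_derivative g (at y)) ^^ n) f differentiable (at x))"

lemma tau_gt_1: "tau > 1"
  unfolding tau_def using real_less_rsqrt[of 1 5] by simp

lemma tau_square: "tau * tau = tau + 1"
  unfolding tau_def by (simp add: field_simps)

lemma fib_B_eq:
  assumes "\<kappa> > 0"
  shows "fib_B \<kappa> = (2 * tau - 1) / (\<kappa> + tau - 1)"
  using assms tau_gt_1 unfolding fib_B_def fib_eps_def by (simp add: field_simps)

lemma fib_A_eq: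
  assumes "\<kappa> > 0"
  shows "fib_A \<kappa> = \<kappa> * fib_B \<kappa>"
proof -
  have nz: "\<kappa> + tau - 1 > 0" "tau > 0" using assms tau_gt_1 by auto
  have "tau * tau * (\<kappa> + tau - 1) - (tau - \<kappa>) = \<kappa> * (2 * tau - 1) * tau"
    using tau_square by algebra
  moreover have "fib_A \<kappa> = (tau * tau * (\<kappa> + tau - 1) - (tau - \<kappa>)) / (tau * (\<kappa> + tau - 1))"
    unfolding fib_A_def fib_eps_def using nz by (simp add: diff_divide_distrib mult.commute)
  ultimately have "fib_A \<kappa> = \<kappa> * (2 * tau - 1) * tau / (tau * (\<kappa> + tau - 1))"
    by simp
  also have "\<dots> = \<kappa> * fib_B \<kappa>"
    unfolding fib_B_eq[OF assms] using nz by simp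
  finally show ?thesis .
qed

lemma fib_A_B:
  assumes "\<kappa> > 0"
  shows "fib_A \<kappa> > 0" "fib_B \<kappa> > 0" "fib_A \<kappa> / fib_B \<kappa> = \<kappa>"
proof -
  show B: "fib_B \<kappa> > 0"
    unfolding fib_B_eq[OF assms] using assms tau_gt_1 by simp
  then show "fib_A \<kappa> > 0" "fib_A \<kappa> / fib_B \<kappa> = \<kappa>"
    unfolding fib_A_eq[OF assms] using assms by simp_all
qed

end

theory Submission
  imports Defs "HOL-Complex_Analysis.Complex_Analysis" "HOL-Number_Theory.Cong"
begin

text \<open>
  Put \<open>s\<^sub>m = m / \<tau> - round (m / \<tau>)\<close>. Since \<open>A / \<tau> + (1 - 1 / \<tau>) B = a\<close> for every \<open>\<kappa>\<close>, the chain is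
  \<open>x\<^sub>m = m a - s\<^sub>m (A - B)\<close>, and \<open>exp (i K x\<^sub>m) = exp (i c s\<^sub>m)\<close> with
  \<open>c = 2 \<pi> n\<^sub>2 - K (A - B)\<close>. The points \<open>s\<^sub>m\<close> are equidistributed in \<open>[-1/2, 1/2)\<close>, so the
  amplitude is the integral of \<open>exp (i c s)\<close>, that is \<open>sinc (c / 2)\<close>. The function \<open>sinc\<close> is entire
  and \<open>c\<close> is a rational function of \<open>\<kappa>\<close> without poles for \<open>Re \<kappa> > 0\<close>.
\<close>

section \<open>Equidistribution of irrational rotations\<close>

text \<open>As \<open>p\<close> is invertible modulo \<open>q\<close>, \<open>i\<close> maps
  injectively to the residue of \<open>r + i * p\<close>. So the residues are merely permuted, and a
  \<open>q\<close>-periodic \<open>g\<close> does not notice the reduction.\<close>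

lemma sum_arith_progression_mod:
  fixes g :: "int \<Rightarrow> 'b::comm_monoid_add" and p r :: int and q :: nat
  assumes "q > 0" and "coprime p (int q)" and per: "\<And>n. g (n mod int q) = g n"
  shows "(\<Sum>i<q. g (r + int i * p)) = (\<Sum>k<q. g (int k))"
proof -
  let ?\<phi> = "\<lambda>i. nat ((r + int i * p) mod int q)"
  have "inj_on ?\<phi> {..<q}"
  proof (rule inj_onI)
    fix i j assume ij: "i \<in> {..<q}" "j \<in> {..<q}" and "?\<phi> i = ?\<phi> j"
    then have "[r + int i * p = r + int j * p] (mod int q)"
      using \<open>q > 0\<close> by (simp add: cong_def nat_eq_iff)
    then have "[int i = int j] (mod int q)"
      using assms(2) by (simp add: cong_add_lcancel cong_mult_rcancel)
    then show "i = j"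
      using ij by (simp add: cong_def)
  qed
  moreover have "?\<phi> ` {..<q} \<subseteq> {..<q}"
    using \<open>q > 0\<close> by (auto simp: nat_less_iff)
  ultimately have bij: "bij_betw ?\<phi> {..<q} {..<q}"
    by (simp add: bij_betw_def endo_inj_surj)
  have "(\<Sum>k<q. g (int k)) = (\<Sum>i<q. g (int (?\<phi> i)))"
    by (rule sum.reindex_bij_betw [OF bij, symmetric])
  also have "\<dots> = (\<Sum>i<q. g (r + int i * p))"
    using \<open>q > 0\<close> by (simp add: per)
  finally show ?thesis by simp
qed

lemma periodic_add_of_int:
  fixes P :: "real \<Rightarrow> 'b"
  assumes "\<And>x. P (x + 1) = P x"
  shows "P (x + of_int n) = P x"
proof (induction n rule: int_induct [of _ 0])
  case (step1 i)
  then show ?case using assms [of "x + of_int i"] by (simp add: add.assoc)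
next
  case (step2 i)
  then show ?case using assms [of "x + of_int (i - 1)"] by (simp add: add.assoc)
qed simp

text \<open>Modulo 1 the orbit of the rotation by \<open>p / q\<close> visits each grid point
  \<open>k / q\<close> exactly once; the common offset \<open>\<theta>\<close> is carried
  along.\<close>

lemma sum_periodic_rational_rotation:
  fixes P :: "real \<Rightarrow> 'b::comm_monoid_add" and p r :: int and q :: nat
  assumes "q > 0" and "coprime p (int q)" and per: "\<And>x. P (x + 1) = P x"
  shows "(\<Sum>i<q. P (of_int (r + int i * p) / real q + \<theta>)) = (\<Sum>k<q. P (real k / real q + \<theta>))"
proof -
  have "P (of_int (n mod int q) / real q + \<theta>) = P (of_int n / real q + \<theta>)" for n
  proof -
    have "real_of_int n = real q * of_int (n div int q) + of_int (n mod int q)"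
      by (metis mult_div_mod_eq of_int_add of_int_mult of_int_of_nat_eq)
    then have "of_int n / real q + \<theta> = of_int (n mod int q) / real q + \<theta> + of_int (n div int q)"
      using \<open>q > 0\<close> by (simp add: field_simps)
    then show ?thesis
      using periodic_add_of_int [of P, OF per] by metis
  qed
  from sum_arith_progression_mod [OF assms(1,2), of "\<lambda>n. P (of_int n / real q + \<theta>)", OF this, of r]
  show ?thesis by simp
qed

section \<open>Quadrature of Lipschitz functions\<close>

lemma lipschitz_one_point_quadrature:
  fixes h :: "real \<Rightarrow> 'b::banach"
  assumes lip: "L-lipschitz_on {a..b} h" and x: "x \<in> {a..b}"
  shows "norm ((b - a) *\<^sub>R h x - integral {a..b} h) \<le> L * (b - a)\<^sup>2"
proof -
  have L: "L \<ge> 0" using lip by (rule lipschitz_on_nonneg)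
  have int: "h integrable_on {a..b}"
    by (intro integrable_continuous_real lipschitz_on_continuous_on [OF lip])
  have "(b - a) *\<^sub>R h x - integral {a..b} h = integral {a..b} (\<lambda>t. h x - h t)"
    using x int by (subst integral_diff) auto
  also have "norm \<dots> \<le> L * (b - a) * (b - a)"
  proof (rule integral_bound)
    fix t assume t: "t \<in> {a..b}"
    have "norm (h x - h t) \<le> L * \<bar>x - t\<bar>"
      using lipschitz_onD [OF lip x t] by (simp add: dist_norm)
    also have "\<dots> \<le> L * (b - a)"
      using L x t by (intro mult_left_mono) auto
    finally show "norm (h x - h t) \<le> L * (b - a)" .
  qed (use x in \<open>auto intro!: continuous_intros lipschitz_on_continuous_on [OF lip]\<close>)
  finally show ?thesis by (simp add: power2_eq_square mult.assoc)
qed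

text \<open>Each cell of length \<open>1 / q\<close> has quadrature error \<open>L / q^2\<close>,
  which the factor \<open>q\<close> scales to \<open>L / q\<close>. Summing over \<open>q\<close>
  cells leaves a bound that does not grow with \<open>q\<close>.\<close>

lemma lipschitz_riemann_sum:
  fixes h :: "real \<Rightarrow> 'b::banach" and q :: nat
  assumes lip: "L-lipschitz_on {0..1} h" and "q > 0" and \<theta>: "0 \<le> \<theta>" "\<theta> < 1"
  shows "norm ((\<Sum>k<q. h ((real k + \<theta>) / q)) - real q *\<^sub>R integral {0..1} h) \<le> L"
proof -
  have int: "h integrable_on {0..1}"
    by (intro integrable_continuous_real lipschitz_on_continuous_on [OF lip])
  have split: "integral {0..real n / q} h = (\<Sum>k<n. integral {real k / q..real (Suc k) / q} h)"
    if "n \<le> q" for n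
    using that
  proof (induction n)
    case (Suc n)
    have "h integrable_on {0..real (Suc n) / q}"
      using Suc.prems by (intro integrable_subinterval_real [OF int]) auto
    then have "integral {0..real n / q} h + integral {real n / q..real (Suc n) / q} h
        = integral {0..real (Suc n) / q} h"
      by (intro Henstock_Kurzweil_Integration.integral_combine) (auto simp: divide_right_mono)
    then show ?case using Suc by simp
  qed simp
  have "integral {0..1} h = (\<Sum>k<q. integral {real k / q..real (Suc k) / q} h)"
    using split [of q] \<open>q > 0\<close> by simp
  then have "(\<Sum>k<q. h ((real k + \<theta>) / q)) - real q *\<^sub>R integral {0..1} h =
      (\<Sum>k<q. h ((real k + \<theta>) / q) - real q *\<^sub>R integral {real k / q..real (Suc k) / q} h)"
    by (simp add: sum_subtractf scaleR_sum_right)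
  also have "norm \<dots> \<le> (\<Sum>k<q. L / q)"
  proof (rule sum_norm_le)
    fix k assume "k \<in> {..<q}"
    then have "{real k / q..real (Suc k) / q} \<subseteq> {0..1}"
      by (auto intro: order_trans simp: divide_le_eq)
    then have "L-lipschitz_on {real k / q..real (Suc k) / q} h"
      by (rule lipschitz_on_subset [OF lip])
    from lipschitz_one_point_quadrature [OF this, of "(real k + \<theta>) / q"]
    have *: "norm ((1 / q) *\<^sub>R h ((real k + \<theta>) / q) - integral {real k / q..real (Suc k) / q} h)
        \<le> L * (1 / q)\<^sup>2"
      using \<theta> by (simp add: diff_divide_distrib [symmetric] divide_right_mono)
    have "h ((real k + \<theta>) / q) - real q *\<^sub>R integral {real k / q..real (Suc k) / q} h =
      real q *\<^sub>R ((1 / q) *\<^sub>R h ((real k + \<theta>) / q) - integral {real k / q..real (Suc k) / q} h)"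
      using \<open>q > 0\<close> by (simp add: scaleR_diff_right)
    also have "norm \<dots> \<le> real q * (L * (1 / q)\<^sup>2)"
      using * by (simp add: mult_left_mono)
    finally show "norm (h ((real k + \<theta>) / q) - real q *\<^sub>R integral {real k / q..real (Suc k) / q} h) \<le> L / q"
      using \<open>q > 0\<close> by (simp add: power2_eq_square)
  qed
  finally show ?thesis using \<open>q > 0\<close> by simp
qed

text \<open>Since \<open>h 0\<close> and \<open>h 1\<close> may differ, \<open>h (frac x)\<close>
  can jump at integers. Writing \<open>frac\<close> as \<open>x\<close> minus its floor separates
  the displacement from the number of integers crossed.\<close>

lemma norm_diff_lipschitz_frac_le:
  fixes h :: "real \<Rightarrow> 'b::real_normed_vector"
  assumes lip: "L-lipschitz_on {0..1} h"
  shows "norm (h (frac x) - h (frac y)) \<le> L * \<bar>x - y\<bar> + L * \<bar>of_int \<lfloor>x\<rfloor> - of_int \<lfloor>y\<rfloor>\<bar>"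
proof -
  have "norm (h (frac x) - h (frac y)) \<le> L * \<bar>frac x - frac y\<bar>"
    using lipschitz_onD [OF lip, of "frac x" "frac y"]
    by (simp add: dist_norm frac_ge_0 less_imp_le frac_lt_1)
  also have "\<dots> \<le> L * (\<bar>x - y\<bar> + \<bar>of_int \<lfloor>x\<rfloor> - of_int \<lfloor>y\<rfloor>\<bar>)"
    using lipschitz_on_nonneg [OF lip] by (intro mult_left_mono) (auto simp: frac_def)
  finally show ?thesis by (simp add: distrib_left)
qed

text \<open>A rotation by \<open>\<alpha> \<approx> p / q\<close> differs from the rational one by at most \<open>1 / q\<close> over \<open>q\<close>
  steps. The jumps of \<open>frac\<close> are counted by a telescoping sum of floors, so that no case
  distinction on the orbit points near an integer is needed.\<close>

lemma rotation_block_sum: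
  fixes h :: "real \<Rightarrow> 'b::banach" and p :: int and q :: nat
  assumes lip: "L-lipschitz_on {0..1} h" and q: "q > 0" and cop: "coprime p (int q)"
    and approx: "\<bar>\<alpha> - of_int p / real q\<bar> \<le> 1 / (real q)\<^sup>2"
  shows "norm ((\<Sum>i<q. h (frac (x + real i * \<alpha>))) - real q *\<^sub>R integral {0..1} h) \<le> 4 * L"
proof -
  have L: "L \<ge> 0" using lip by (rule lipschitz_on_nonneg)
  \<comment> \<open>The start \<open>x\<close> is split into a grid point \<open>r / q\<close>,
    which the permutation of residues absorbs, and an offset \<open>\<theta> / q\<close> within a
    cell.\<close>
  define r where "r = \<lfloor>real q * x\<rfloor>"
  define \<theta> where "\<theta> = frac (real q * x)"
  have \<theta>: "0 \<le> \<theta>" "\<theta> < 1" by (simp_all add: \<theta>_def frac_ge_0 frac_lt_1)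
  have x: "x = (of_int r + \<theta>) / q"
    using q by (simp add: r_def \<theta>_def frac_def)
  define y where "y = (\<lambda>i::nat. of_int (r + int i * p) / real q + \<theta> / q)"
  have xy: "\<bar>x + real i * \<alpha> - y i\<bar> \<le> 1 / q" if "i < q" for i
  proof -
    have "x + real i * \<alpha> - y i = real i * (\<alpha> - of_int p / real q)"
      using q by (simp add: x y_def field_simps)
    also have "\<bar>\<dots>\<bar> \<le> real q * (1 / (real q)\<^sup>2)"
      unfolding abs_mult using that approx by (intro mult_mono) auto
    finally show ?thesis using q by (simp add: power2_eq_square)
  qed
  \<comment> \<open>\<open>J t\<close> counts the integers in the half-open window from
    \<open>t - 1 / q\<close> to \<open>t + 1 / q\<close>. It bounds the floor jump to any point
    within \<open>1 / q\<close> of \<open>t\<close>, and its periodicity allows summation over the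
    grid.\<close>
  define J where "J = (\<lambda>t. real_of_int (\<lfloor>t + 1 / q\<rfloor> - \<lfloor>t - 1 / q\<rfloor>))"
  have J_per: "J (t + 1) = J t" for t
  proof -
    have "\<lfloor>t + 1 + 1 / q\<rfloor> = \<lfloor>t + 1 / q\<rfloor> + 1" "\<lfloor>t + 1 - 1 / q\<rfloor> = \<lfloor>t - 1 / q\<rfloor> + 1"
      by linarith+
    then show ?thesis by (simp add: J_def)
  qed
  have "(\<Sum>i<q. J (y i)) = (\<Sum>k<q. J (real k / q + \<theta> / q))"
    unfolding y_def by (rule sum_periodic_rational_rotation [where P = J, OF q cop J_per])
  \<comment> \<open>The window around \<open>(k + \<theta>) / q\<close> is two cells wide; adding
    and subtracting the floor at its midpoint makes the sum telescope.\<close>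
  also have "\<dots> = (\<Sum>k<q. (of_int \<lfloor>(real (Suc (Suc k)) + \<theta> - 1) / q\<rfloor> + of_int \<lfloor>(real (Suc k) + \<theta> - 1) / q\<rfloor>)
      - (of_int \<lfloor>(real (Suc k) + \<theta> - 1) / q\<rfloor> + of_int \<lfloor>(real k + \<theta> - 1) / q\<rfloor>))"
    by (intro sum.cong) (auto simp: J_def add_divide_distrib diff_divide_distrib algebra_simps)
  also have "\<dots> = 2"
  proof -
    let ?u = "\<lambda>k. real_of_int \<lfloor>(real (Suc k) + \<theta> - 1) / q\<rfloor> + of_int \<lfloor>(real k + \<theta> - 1) / q\<rfloor>"
    have shift: "\<lfloor>(real q + t) / q\<rfloor> = \<lfloor>t / q\<rfloor> + 1" for t
      using q by (simp add: add_divide_distrib)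
    have "(\<Sum>k<q. ?u (Suc k) - ?u k) = ?u q - ?u 0"
      by (rule sum_lessThan_telescope)
    also have "\<dots> = 2"
      using shift [of \<theta>] shift [of "\<theta> - 1"] by (simp add: algebra_simps)
    finally show ?thesis by simp
  qed
  finally have J_sum: "(\<Sum>i<q. J (y i)) = 2" .
  have "norm ((\<Sum>i<q. h (frac (x + real i * \<alpha>))) - (\<Sum>i<q. h (frac (y i))))
      \<le> (\<Sum>i<q. L * (1 / q) + L * J (y i))"
    unfolding sum_subtractf [symmetric]
  proof (rule sum_norm_le)
    fix i assume "i \<in> {..<q}"
    then have d: "\<bar>x + real i * \<alpha> - y i\<bar> \<le> 1 / q" using xy by simp
    then have "\<lfloor>y i - 1 / q\<rfloor> \<le> \<lfloor>x + real i * \<alpha>\<rfloor>" "\<lfloor>x + real i * \<alpha>\<rfloor> \<le> \<lfloor>y i + 1 / q\<rfloor>"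
      "\<lfloor>y i - 1 / q\<rfloor> \<le> \<lfloor>y i\<rfloor>" "\<lfloor>y i\<rfloor> \<le> \<lfloor>y i + 1 / q\<rfloor>"
      by (auto intro!: floor_mono)
    then have "\<bar>real_of_int \<lfloor>x + real i * \<alpha>\<rfloor> - of_int \<lfloor>y i\<rfloor>\<bar> \<le> J (y i)"
      unfolding J_def by linarith
    then show "norm (h (frac (x + real i * \<alpha>)) - h (frac (y i))) \<le> L * (1 / q) + L * J (y i)"
      using d L by (intro order_trans [OF norm_diff_lipschitz_frac_le [OF lip]] add_mono mult_left_mono) auto
  qed
  \<comment> \<open>The displacements contribute \<open>q * (L / q)\<close>, the jumps
    \<open>2 * L\<close>. The Riemann sum error below adds a fourth \<open>L\<close>.\<close>
  also have "\<dots> = 3 * L"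
    using q by (simp add: sum.distrib sum_distrib_left [symmetric] J_sum)
  finally have 1: "norm ((\<Sum>i<q. h (frac (x + real i * \<alpha>))) - (\<Sum>i<q. h (frac (y i)))) \<le> 3 * L" .
  have "(\<Sum>i<q. h (frac (y i))) = (\<Sum>k<q. h (frac (real k / q + \<theta> / q)))"
    unfolding y_def
    by (rule sum_periodic_rational_rotation [OF q cop, of "\<lambda>t. h (frac t)"]) (simp add: frac_1_eq)
  also have "\<dots> = (\<Sum>k<q. h ((real k + \<theta>) / q))"
  proof (intro sum.cong refl arg_cong [of _ _ h])
    fix k assume "k \<in> {..<q}"
    then have "real k + \<theta> < q" using \<theta> by (simp add: less_eq_real_def)
    then show "frac (real k / q + \<theta> / q) = (real k + \<theta>) / q"
      using q \<theta> by (simp add: frac_eq add_divide_distrib [symmetric])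
  qed
  finally have 2: "norm ((\<Sum>i<q. h (frac (y i))) - real q *\<^sub>R integral {0..1} h) \<le> L"
    using lipschitz_riemann_sum [OF lip q \<theta>] by simp
  show ?thesis
    using norm_triangle_mono [OF 1 2] by simp
qed

lemma sum_lessThan_add:
  fixes f :: "nat \<Rightarrow> 'b::comm_monoid_add"
  shows "(\<Sum>m<a + b. f m) = (\<Sum>m<a. f m) + (\<Sum>i<b. f (a + i))"
  by (induction b) (simp_all add: add.assoc)

text \<open>An irrational \<open>\<alpha>\<close> has approximations \<open>p / q\<close> of
  Dirichlet quality with \<open>q\<close> arbitrarily large. Cutting the orbit into blocks of length
  \<open>q\<close> costs \<open>4 * L\<close> per block, hence \<open>4 * L / q\<close> per point;
  the incomplete last block is negligible as \<open>N\<close> grows.\<close>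

theorem irrational_rotation_mean:
  fixes h :: "real \<Rightarrow> 'b::banach"
  assumes irr: "\<alpha> \<notin> \<rat>" and lip: "L-lipschitz_on {0..1} h"
  shows "(\<lambda>N. (1 / real N) *\<^sub>R (\<Sum>m<N. h (frac (x + real m * \<alpha>)))) \<longlonglongrightarrow> integral {0..1} h"
proof (rule LIMSEQ_I)
  fix e :: real assume e: "e > 0"
  have L: "L \<ge> 0" using lip by (rule lipschitz_on_nonneg)
  let ?I = "integral {0..1} h"
  define S where "S = (\<lambda>N. (\<Sum>m<N. h (frac (x + real m * \<alpha>))) - real N *\<^sub>R ?I)"
  have "infinite (approx_set \<alpha>)"
    using irr rational_iff_finite_approx_set by blast
  \<comment> \<open>The threshold makes the block error per point, \<open>4 * L / q\<close>, less
    than \<open>e / 2\<close>.\<close>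
  from infinite_approx_set [OF this, of "\<lceil>8 * L / e\<rceil>"]
  obtain p k where pk: "(p, k) \<in> approx_set \<alpha>" "k > \<lceil>8 * L / e\<rceil>" by blast
  define q where "q = nat k"
  have kq: "k = int q" and q: "q > 0" "coprime p (int q)" "real q > 8 * L / e"
    and approx: "\<bar>\<alpha> - of_int p / real q\<bar> \<le> 1 / (real q)\<^sup>2"
    using pk by (auto simp: approx_set_def q_def ceiling_less_iff)
  have blocks: "norm (S (n * q + s)) \<le> 4 * L * real n + L * real s" for n s
  proof -
    have full: "norm (S (n * q)) \<le> 4 * L * real n" for n
    proof (induction n)
      case (Suc n)
      have "S (n * q + q) = S (n * q) + ((\<Sum>i<q. h (frac (x + real (n * q) * \<alpha> + real i * \<alpha>))) - real q *\<^sub>R ?I)"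
        using sum_lessThan_add [of "\<lambda>m. h (frac (x + real m * \<alpha>))" "n * q" q]
        by (simp add: S_def algebra_simps)
      also have "norm \<dots> \<le> 4 * L * real n + 4 * L"
        by (intro norm_triangle_mono Suc.IH rotation_block_sum [OF lip q(1,2) approx])
      finally show ?case by (simp add: add.commute distrib_left)
    qed (simp add: S_def)
    show ?thesis
    proof (induction s)
      case (Suc s)
      have "S (n * q + Suc s) = S (n * q + s) + (h (frac (x + real (n * q + s) * \<alpha>)) - ?I)"
        by (simp add: S_def algebra_simps)
      \<comment> \<open>A single leftover term is a one-point quadrature on the whole unit interval,
        with error at most \<open>L\<close>.\<close>
      also have "norm \<dots> \<le> (4 * L * real n + L * real s) + L"
        using lipschitz_one_point_quadrature [OF lip, of "frac (x + real (n * q + s) * \<alpha>)"]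
        by (intro norm_triangle_mono Suc.IH) (simp add: frac_ge_0 less_imp_le frac_lt_1)
      finally show ?case by (simp add: algebra_simps)
    qed (use full in simp)
  qed
  obtain N0 :: nat where N0: "real N0 > 2 * L * real q / e" "N0 > 0"
    using reals_Archimedean2 [of "max 0 (2 * L * real q / e)"] by auto
  show "\<exists>N0. \<forall>N\<ge>N0. norm ((1 / real N) *\<^sub>R (\<Sum>m<N. h (frac (x + real m * \<alpha>))) - ?I) < e"
  proof (intro exI allI impI)
    fix N assume "N \<ge> N0"
    then have N: "N > 0" "2 * L * real q / e < real N" using N0 by auto
    have "norm (S N) \<le> 4 * L * real (N div q) + L * real (N mod q)"
      using blocks [of "N div q" "N mod q"] by simp
    also have "\<dots> \<le> 4 * L * (real N / real q) + L * real q"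
      using L q(1) by (intro add_mono mult_left_mono) (auto simp: of_nat_div_le_of_nat less_imp_le)
    also have "\<dots> < e / 2 * real N + e / 2 * real N"
    proof (intro add_le_less_mono)
      show "4 * L * (real N / real q) \<le> e / 2 * real N"
        using q e N by (simp add: field_simps)
      show "L * real q < e / 2 * real N"
        using N e by (simp add: field_simps)
    qed
    finally have "norm (S N) < e * real N" by simp
    moreover have "(1 / real N) *\<^sub>R (\<Sum>m<N. h (frac (x + real m * \<alpha>))) - ?I = (1 / real N) *\<^sub>R S N"
      using N by (simp add: S_def scaleR_diff_right)
    ultimately show "norm ((1 / real N) *\<^sub>R (\<Sum>m<N. h (frac (x + real m * \<alpha>))) - ?I) < e"
      using N by (simp add: field_simps)
  qed
qed

section \<open>Smoothness of restrictions of holomorphic functions\<close>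

text \<open>On the real axis the derivative of a restriction is the restriction of the complex
  derivative, which is again holomorphic. By induction every iterated derivative agrees on
  \<open>S\<close> with one of \<open>F\<close>; as \<open>S\<close> is open, agreement there
  suffices to differentiate once more.\<close>

lemma infinitely_differentiable_on_of_holomorphic:
  fixes f :: "real \<Rightarrow> complex"
  assumes "open S" "open U" and F: "F holomorphic_on U" and SU: "of_real ` S \<subseteq> U"
    and eq: "\<And>x. x \<in> S \<Longrightarrow> f x = F (of_real x)"
  shows "infinitely_differentiable_on S f"
proof -
  let ?D = "\<lambda>n. ((\<lambda>g y. vector_derivative g (at y)) ^^ n) f"
  have hol: "(deriv ^^ n) F holomorphic_on U" for n
    by (induction n) (auto intro: holomorphic_deriv F \<open>open U\<close>)
  have der: "(g has_vector_derivative deriv G (of_real x)) (at x)"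
    if "x \<in> S" "G holomorphic_on U" "\<And>x. x \<in> S \<Longrightarrow> g x = G (of_real x)" for g G x
  proof -
    have "(G has_field_derivative deriv G (of_real x)) (at (of_real x))"
      using that SU \<open>open U\<close> by (intro holomorphic_derivI) auto
    then have "((\<lambda>x. G (of_real x)) has_vector_derivative deriv G (of_real x)) (at x)"
      by (rule has_vector_derivative_real_field)
    then show ?thesis
      by (rule has_vector_derivative_transform_within_open [OF _ \<open>open S\<close> that(1)]) (simp add: that)
  qed
  have iter: "\<forall>x\<in>S. ?D n x = (deriv ^^ n) F (of_real x)" for n
  proof (induction n)
    case (Suc n)
    then show ?case
      using der [OF _ hol [of n], of _ "?D n"] by (auto intro!: vector_derivative_at)
  qed (use eq in simp)
  show ?thesis
    unfolding infinitely_differentiable_on_def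
    using der [OF _ hol] iter by (metis differentiableI_vector)
qed

section \<open>The sinc function and its integral representation\<close>

definition sinc_complex :: "complex \<Rightarrow> complex" where
  "sinc_complex z = (if z = 0 then 1 else sin z / z)"

text \<open>This is the difference quotient of \<open>sin\<close> at 0, completed by the derivative
  there, so the singularity is removable.\<close>

lemma sinc_complex_holomorphic: "sinc_complex holomorphic_on S"
proof -
  have "deriv sin (0::complex) = 1"
    by (intro DERIV_imp_deriv) (auto intro!: derivative_eq_intros)
  then have "sinc_complex = (\<lambda>z. if z = 0 then deriv sin 0 else (sin z - sin 0) / (z - 0))"
    by (simp add: fun_eq_iff sinc_complex_def)
  moreover have "\<dots> holomorphic_on UNIV"
    by (rule pole_lemma_open) (auto intro: holomorphic_on_sin)
  ultimately show ?thesis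
    using holomorphic_on_subset by auto
qed

lemma integral_exp_symmetric_eq_sinc:
  "integral {0..1} (\<lambda>t. exp (\<i> * of_real (c * (t - 1/2)))) = sinc_complex (of_real (c / 2))"
proof (cases "c = 0")
  case False
  have "((\<lambda>t. exp (\<i> * of_real (c * (t - 1/2)))) has_integral
      exp (\<i> * of_real (c * (1 - 1/2))) / (\<i> * of_real c) - exp (\<i> * of_real (c * (0 - 1/2))) / (\<i> * of_real c)) {0..1}"
  proof (rule fundamental_theorem_of_calculus)
    fix t :: real
    have "((\<lambda>z. exp (\<i> * (of_real c * (z - 1/2))) / (\<i> * of_real c)) has_field_derivative
        exp (\<i> * (of_real c * (of_real t - 1/2)))) (at (of_real t))"
      using False by (auto intro!: derivative_eq_intros simp: mult.commute [of _ \<i>])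
    from has_vector_derivative_real_field [OF this]
    show "((\<lambda>t. exp (\<i> * of_real (c * (t - 1/2))) / (\<i> * of_real c)) has_vector_derivative
        exp (\<i> * of_real (c * (t - 1/2)))) (at t within {0..1})"
      by (simp add: has_vector_derivative_at_within)
  qed simp
  note integral_unique [OF this]
  \<comment> \<open>The endpoint exponentials have opposite exponents because the interval is
    centred, so their difference is a sine.\<close>
  also have "exp (\<i> * of_real (c * (1 - 1/2))) / (\<i> * of_real c) - exp (\<i> * of_real (c * (0 - 1/2))) / (\<i> * of_real c)
      = sinc_complex (of_real (c / 2))"
    using False by (simp add: sinc_complex_def sin_exp_eq field_simps)
  finally show ?thesis .
qed (simp add: sinc_complex_def)

section \<open>The Fibonacci chain\<close>

text \<open>Otherwise \<open>sqrt 5\<close> would be a rational algebraic integer, hence an integer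
  strictly between 2 and 3.\<close>

lemma inverse_tau_irrational: "1 / tau \<notin> \<rat>"
proof
  assume "1 / tau \<in> \<rat>"
  then have "1 / (1 / tau) \<in> \<rat>" by (rule Rats_divide [OF Rats_1])
  then have "2 * tau - 1 \<in> \<rat>" by simp
  moreover have "2 * tau - 1 = sqrt 5" by (simp add: tau_def field_simps)
  ultimately have "sqrt 5 \<in> \<rat>" by simp
  moreover have "algebraic_int (sqrt 5)"
    by (intro algebraic_int_sqrt) simp
  ultimately obtain n where n: "sqrt 5 = of_int n"
    using rational_algebraic_int_is_int by (metis Ints_cases)
  have "2 < sqrt 5" "sqrt 5 < 3"
    by (auto intro: real_less_rsqrt real_less_lsqrt)
  then have "2 < n" "n < 3" by (simp_all add: n)
  then show False by simp
qed

text \<open>This is the constant \<open>c\<close> of the overview; it depends on \<kappa> only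
  through \<open>A - B\<close>.\<close>

definition peak_phase :: "int \<Rightarrow> int \<Rightarrow> real \<Rightarrow> real" where
  "peak_phase n1 n2 \<kappa> = 2 * pi * of_int n2 - peak_pos n1 n2 * (fib_A \<kappa> - fib_B \<kappa>)"

text \<open>The mean spacing \<open>fib_a\<close> of the chain does not depend on \<open>\<kappa>\<close>, and \<open>m * fib_a\<close> times the
  peak position is \<open>2 * pi * n2 * m / tau\<close> modulo \<open>2 * pi\<close>.\<close>

lemma exp_peak_chain:
  "exp (\<i> * of_real (peak_pos n1 n2 * fib_chain \<kappa> m)) =
    exp (\<i> * of_real (peak_phase n1 n2 \<kappa> * (frac (1/2 + of_int m * (1 / tau)) - 1/2)))"
proof -
  define r where "r = round (of_int m / tau)"
  define s where "s = of_int m / tau - of_int r"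
  have nz: "tau \<noteq> 0" "tau + 1 \<noteq> 0" "tau + 2 \<noteq> 0" using tau_gt_1 by auto
  have inv: "1 / tau = tau - 1"
    using tau_square nz by (simp add: field_simps)
  have a: "fib_a = 3 - tau"
    using tau_square nz by (simp add: fib_a_def field_simps)
  \<comment> \<open>The lengths are weighted by their frequencies \<open>1 / tau = tau - 1\<close>
    and \<open>2 - tau\<close>; \<open>fib_eps\<close> cancels because the square of
    \<open>tau - 1\<close> is \<open>2 - tau\<close>.\<close>
  have spacing: "fib_a = fib_A \<kappa> * (tau - 1) + (2 - tau) * fib_B \<kappa>"
  proof -
    have "fib_eps \<kappa> / tau = fib_eps \<kappa> * (tau - 1)"
      using inv by (metis mult.right_neutral times_divide_eq_right)
    then show ?thesis
      unfolding fib_A_def fib_B_def a using tau_square by algebra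
  qed
  have "of_int m / tau = of_int m * (tau - 1)"
    using inv by (metis mult.right_neutral times_divide_eq_right)
  then have s_eq: "s = of_int m * (tau - 1) - of_int r"
    by (simp add: s_def)
  have x: "fib_chain \<kappa> m = of_int m * fib_a - s * (fib_A \<kappa> - fib_B \<kappa>)"
    unfolding fib_chain_def r_def [symmetric] s_eq spacing by (simp add: algebra_simps)
  have "fib_a \<noteq> 0" using nz by (simp add: fib_a_def)
  then have K: "peak_pos n1 n2 * fib_a = 2 * pi * (of_int n1 + of_int n2 / tau)"
    using nz by (simp add: peak_pos_def k0_def q0_def field_simps)
  have "peak_pos n1 n2 * fib_chain \<kappa> m = of_int m * (peak_pos n1 n2 * fib_a) - peak_pos n1 n2 * s * (fib_A \<kappa> - fib_B \<kappa>)"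
    unfolding x by algebra
  also have "\<dots> = 2 * pi * of_int n2 * (of_int m / tau) - peak_pos n1 n2 * s * (fib_A \<kappa> - fib_B \<kappa>) + 2 * pi * of_int (m * n1)"
    unfolding K by (simp add: algebra_simps)
  also have "of_int m / tau = s + of_int r" by (simp add: s_def)
  \<comment> \<open>Substituting \<open>s + r\<close> for \<open>m / tau\<close> leaves terms linear
    in \<open>s\<close>, plus \<open>n2 * r\<close> and \<open>m * n1\<close> full turns.\<close>
  finally have phase: "peak_pos n1 n2 * fib_chain \<kappa> m =
      peak_phase n1 n2 \<kappa> * s + 2 * of_int (n2 * r + m * n1) * pi"
    by (simp add: peak_phase_def algebra_simps)
  \<comment> \<open>Rounding half up is the floor of the argument plus 1/2, hence the shift of the
    rotation by 1/2.\<close>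
  have s: "s = frac (1/2 + of_int m * (1 / tau)) - 1/2"
    by (simp add: s_def r_def round_def frac_def add.commute)
  have "exp (\<i> * of_real (peak_phase n1 n2 \<kappa> * s + 2 * of_int k * pi)) = exp (\<i> * of_real (peak_phase n1 n2 \<kappa> * s))" for k
    by (simp add: exp_eq) (intro exI [of _ k], simp add: algebra_simps)
  then show ?thesis
    unfolding phase s [symmetric] by blast
qed

lemma lipschitz_exp_imaginary:
  assumes "convex S"
  shows "\<bar>c\<bar>-lipschitz_on S (\<lambda>t. exp (\<i> * of_real (c * (t - b))))"
proof (rule bounded_derivative_imp_lipschitz [OF _ assms])
  fix t
  have "((\<lambda>z. exp (\<i> * (of_real c * (z - of_real b)))) has_field_derivative
      \<i> * of_real c * exp (\<i> * of_real (c * (t - b)))) (at (of_real t))"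
    by (auto intro!: derivative_eq_intros)
  from has_vector_derivative_real_field [OF this]
  show "((\<lambda>t. exp (\<i> * of_real (c * (t - b)))) has_derivative
      (\<lambda>u. u *\<^sub>R (\<i> * of_real c * exp (\<i> * of_real (c * (t - b)))))) (at t within S)"
    by (simp add: has_vector_derivative_def has_derivative_at_withinI)
  show "onorm (\<lambda>u. u *\<^sub>R (\<i> * of_real c * exp (\<i> * of_real (c * (t - b))))) \<le> \<bar>c\<bar>"
    by (rule onorm_le) (simp add: norm_mult)
qed simp

section \<open>Value and smoothness of the peak amplitude\<close>

lemma exp_mean_tendsto:
  "exp_mean \<kappa> (peak_pos n1 n2) \<longlonglongrightarrow> sinc_complex (of_real (peak_phase n1 n2 \<kappa> / 2))"
proof -
  define c where "c = peak_phase n1 n2 \<kappa>"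
  \<comment> \<open>The mean starts at \<open>m = 1\<close>, the rotation theorem at
    \<open>m = 0\<close>; the extra \<open>1/tau\<close> in the starting point makes up for
    this.\<close>
  have "exp_mean \<kappa> (peak_pos n1 n2) N =
      (1 / real N) *\<^sub>R (\<Sum>m<N. exp (\<i> * of_real (c * (frac ((1/2 + 1/tau) + real m * (1 / tau)) - 1/2))))" for N
  proof -
    have "(\<Sum>m=1..N. exp (\<i> * complex_of_real (peak_pos n1 n2 * fib_chain \<kappa> (int m)))) =
        (\<Sum>m<N. exp (\<i> * complex_of_real (peak_pos n1 n2 * fib_chain \<kappa> (int (Suc m)))))"
      by (rule sum.reindex_bij_witness [of _ Suc "\<lambda>m. m - 1"]) auto
    then show ?thesis
      unfolding exp_mean_def exp_peak_chain c_def
      by (simp add: scaleR_conv_of_real add_divide_distrib add.assoc)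
  qed
  moreover have "\<bar>c\<bar>-lipschitz_on {0..1} (\<lambda>t. exp (\<i> * of_real (c * (t - 1/2))))"
    by (intro lipschitz_exp_imaginary) simp
  from irrational_rotation_mean [OF inverse_tau_irrational this, of "1/2 + 1/tau"]
  have "(\<lambda>N. (1 / real N) *\<^sub>R (\<Sum>m<N. exp (\<i> * of_real (c * (frac ((1/2 + 1/tau) + real m * (1 / tau)) - 1/2)))))
      \<longlonglongrightarrow> sinc_complex (of_real (c / 2))"
    unfolding integral_exp_symmetric_eq_sinc .
  ultimately show ?thesis
    unfolding c_def by presburger
qed

theorem mainTheorem3:
  fixes n1 n2 :: int
  shows "(\<forall>\<kappa>>0. convergent (exp_mean \<kappa> (peak_pos n1 n2))) \<and>
         infinitely_differentiable_on {0<..} (\<lambda>\<kappa>. peak_amplitude \<kappa> (peak_pos n1 n2)) \<and>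
         continuous_on {0<..} (\<lambda>\<kappa>. peak_amplitude \<kappa> (peak_pos n1 n2))"
proof (intro conjI allI impI)
  show "convergent (exp_mean \<kappa> (peak_pos n1 n2))" for \<kappa>
    using exp_mean_tendsto by (rule convergentI)
  \<comment> \<open>\<open>E\<close> extends \<open>fib_eps\<close> to complex arguments, and
    \<open>F\<close> extends the amplitude.\<close>
  define E :: "complex \<Rightarrow> complex" where "E = (\<lambda>z. (of_real tau - z) / (z + of_real tau - 1))"
  define F where "F = (\<lambda>z. sinc_complex ((of_real (2 * pi * of_int n2) -
      of_real (peak_pos n1 n2) * ((of_real tau - E z / of_real tau) - (1 + E z))) / 2))"
  have "F holomorphic_on {z. Re z > 0}"
  proof -
    \<comment> \<open>The only zero is the negative real number \<open>1 - tau\<close>, outside the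
      half-plane.\<close>
    have "z + of_real tau - 1 \<noteq> 0" if "Re z > 0" for z
      using that tau_gt_1 by (auto simp: complex_eq_iff)
    then have "E holomorphic_on {z. Re z > 0}"
      unfolding E_def by (intro holomorphic_intros) auto
    moreover have "tau \<noteq> 0" using tau_gt_1 by simp
    ultimately show ?thesis
      unfolding F_def
      by (intro holomorphic_on_compose [OF _ sinc_complex_holomorphic, unfolded o_def] holomorphic_intros) auto
  qed
  moreover have "peak_amplitude \<kappa> (peak_pos n1 n2) = F (of_real \<kappa>)" for \<kappa>
    using limI [OF exp_mean_tendsto]
    by (simp add: peak_amplitude_def F_def E_def peak_phase_def fib_A_def fib_B_def fib_eps_def)
  ultimately show smooth: "infinitely_differentiable_on {0<..} (\<lambda>\<kappa>. peak_amplitude \<kappa> (peak_pos n1 n2))"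
    by (intro infinitely_differentiable_on_of_holomorphic [of _ "{z. Re z > 0}"])
      (auto simp: open_halfspace_Re_gt)
  show "continuous_on {0<..} (\<lambda>\<kappa>. peak_amplitude \<kappa> (peak_pos n1 n2))"
  proof (intro continuous_at_imp_continuous_on ballI differentiable_imp_continuous_within)
    fix \<kappa> :: real assume "\<kappa> \<in> {0<..}"
    then show "(\<lambda>\<kappa>. peak_amplitude \<kappa> (peak_pos n1 n2)) differentiable at \<kappa>"
      \<comment> \<open>The zeroth iterate is the amplitude itself, so its differentiability gives
        continuity.\<close>
      using smooth [unfolded infinitely_differentiable_on_def, rule_format, of \<kappa> 0] by simp
  qed
qed

end
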